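(* Let $\mathcal{S}$ and $\mathcal{A}$ be a state space and an action space, let $R: \mathcal{S} \times \mathcal{A} \times \mathcal{S} \to \mathbb{R}$ be a reward function, and let $\Phi: \mathcal{S} \to \mathbb{R}$ be a state potential function. Let $\gamma \in [0,1]$ be a discount factor, let $\mathcal{D}_{\mathcal{S}} \in \Delta(\mathcal{S})$ and $\mathcal{D}_{\mathcal{A}} \in \Delta(\mathcal{A})$ be distributions over states and actions, and let $T: \mathcal{S} \times \mathcal{A} \to \Delta(\mathcal{S})$ be a conditional distribution over next states. Let $R'$ denote $R$ shaped by $\Phi$, that is, $R'(s,a,s') = R(s,a,s') + \gamma \Phi(s') - \Phi(s)$ for all $s,s' \in \mathcal{S}$, $a \in \mathcal{A}$. Then the dynamics-aware transformations of $R'$ and $R$ are equal: $C_T(R') = C_T(R)$, i.e. $C_T(R')(s,a,s') = C_T(R)(s,a,s')$ for all $(s,a,s') \in \mathcal{S}\times\mathcal{A}\times\mathcal{S}$.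
   Context: $\Delta(\mathcal{X})$ denotes the set of probability distributions over a (measurable) space $\mathcal{X}$; $T(\cdot \mid s,a) \in \Delta(\mathcal{S})$ is the distribution of the next state given state $s$ and action $a$ (a Markov kernel). Dynamics-aware transformation. Fix $\gamma$, $\mathcal{D}_{\mathcal{A}}$ and $T$ as in the statement. For each $(s,s') \in \mathcal{S}\times\mathcal{S}$ let $A$ be a random variable distributed as $\mathcal{D}_{\mathcal{A}}$, and let $S'$ and $S''$ be $\mathcal{S}$-valued random variables whose conditional distributions given $A$ are $T(\cdot \mid s, A)$ and $T(\cdot \mid s', A)$ respectively. (The joint conditional law of $S'$ and $S''$ given $A$ is any fixed one with these conditional marginals; it depends only on $(s,s')$ and is the same for all reward functions.) For a reward function $R:\mathcal{S}\times\mathcal{A}\times\mathcal{S}\to\mathbb{R}$, the dynamics-aware transformation of $R$ is the function $C_T(R): \mathcal{S}\times\mathcal{A}\times\mathcal{S}\to\mathbb{R}$ given by $$C_T(R)(s,a,s') = R(s,a,s') + \mathbb{E}\big[\gamma R(s',A,S'') - R(s,A,S') - \gamma R(S',A,S'')\big],$$ where the lower-case $s,a,s'$ are fixed and the expectation is over $A, S', S''$. (The distribution $\mathcal{D}_{\mathcal{S}}$ is listed among the data but does not enter this formula.) Standing convention: $R$ and $\Phi$ are measurable, and for all $s,s'\in\mathcal{S}$ the random variables $R(s',A,S'')$, $R(s,A,S')$, $R(S',A,S'')$, $\Phi(S')$ and $\Phi(S'')$ are integrable. *)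

theory Defs
  imports "HOL-Probability.Probability"
begin

type_synonym ('s, 'a) reward = "'s \<Rightarrow> 'a \<Rightarrow> 's \<Rightarrow> real"

definition shaped :: "real \<Rightarrow> ('s, 'a) reward \<Rightarrow> ('s \<Rightarrow> real) \<Rightarrow> ('s, 'a) reward" where
  "shaped \<gamma> R \<Phi> = (\<lambda>s a s'. R s a s' + \<gamma> * \<Phi> s' - \<Phi> s)"

text \<open>
  The conditional distribution of \<open>Y\<close> given \<open>X\<close> is the kernel \<open>\<kappa>\<close>: for every measurable \<open>C\<close>,
  \<open>P(Y \<in> C | X) = \<kappa>(X)(C)\<close> almost surely, where the left-hand side is the conditional
  expectation with respect to the sigma-algebra generated by \<open>X\<close>.
\<close>

definition has_cond_distr ::
  "'w measure \<Rightarrow> 'a measure \<Rightarrow> ('w \<Rightarrow> 'a) \<Rightarrow> 's measure \<Rightarrow> ('w \<Rightarrow> 's) \<Rightarrow> ('a \<Rightarrow> 's measure) \<Rightarrow> bool"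
where
  "has_cond_distr P \<A> X \<S> Y \<kappa> \<longleftrightarrow>
     X \<in> P \<rightarrow>\<^sub>M \<A> \<and> Y \<in> P \<rightarrow>\<^sub>M \<S> \<and> \<kappa> \<in> \<A> \<rightarrow>\<^sub>M prob_algebra \<S> \<and>
     (\<forall>C\<in>sets \<S>. AE w in P.
        real_cond_exp P (vimage_algebra (space P) X \<A>) (\<lambda>w. indicator C (Y w)) w
          = measure (\<kappa> (X w)) C)"

text \<open>
  For each pair \<open>(s, s')\<close> of states, a probability space \<open>P s s'\<close> carrying an action \<open>X s s'\<close>
  (\<open>A\<close> in the usual notation) and next states \<open>Y s s'\<close> (\<open>S'\<close>, drawn from \<open>s\<close>) and \<open>Z s s'\<close>
  (\<open>S''\<close>, drawn from \<open>s'\<close>).  Only the two conditional marginals given the action are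
  prescribed; the joint conditional law of the two next states is unconstrained.
\<close>

definition next_state_variables ::
  "'s measure \<Rightarrow> 'a measure \<Rightarrow> 'a measure \<Rightarrow> ('s \<times> 'a \<Rightarrow> 's measure) \<Rightarrow>
   ('s \<Rightarrow> 's \<Rightarrow> 'w measure) \<Rightarrow> ('s \<Rightarrow> 's \<Rightarrow> 'w \<Rightarrow> 'a) \<Rightarrow>
   ('s \<Rightarrow> 's \<Rightarrow> 'w \<Rightarrow> 's) \<Rightarrow> ('s \<Rightarrow> 's \<Rightarrow> 'w \<Rightarrow> 's) \<Rightarrow> bool"
where
  "next_state_variables \<S> \<A> D\<^sub>A T P X Y Z \<longleftrightarrow>
     (\<forall>s\<in>space \<S>. \<forall>s'\<in>space \<S>.
        prob_space (P s s') \<and>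
        X s s' \<in> P s s' \<rightarrow>\<^sub>M \<A> \<and> distr (P s s') \<A> (X s s') = D\<^sub>A \<and>
        has_cond_distr (P s s') \<A> (X s s') \<S> (Y s s') (\<lambda>a. T (s, a)) \<and>
        has_cond_distr (P s s') \<A> (X s s') \<S> (Z s s') (\<lambda>a. T (s', a)))"

text \<open>
  The transformation depends on the action distribution and the transition kernel only through
  the random variables, which are therefore its arguments; they do not depend on the reward.
\<close>

definition dynamics_aware ::
  "real \<Rightarrow> ('s \<Rightarrow> 's \<Rightarrow> 'w measure) \<Rightarrow> ('s \<Rightarrow> 's \<Rightarrow> 'w \<Rightarrow> 'a) \<Rightarrow>
   ('s \<Rightarrow> 's \<Rightarrow> 'w \<Rightarrow> 's) \<Rightarrow> ('s \<Rightarrow> 's \<Rightarrow> 'w \<Rightarrow> 's) \<Rightarrow>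
   ('s, 'a) reward \<Rightarrow> ('s, 'a) reward"
where
  "dynamics_aware \<gamma> P X Y Z R = (\<lambda>s a s'. R s a s' +
     (\<integral>w. \<gamma> * R s' (X s s' w) (Z s s' w)
          - R s (X s s' w) (Y s s' w)
          - \<gamma> * R (Y s s' w) (X s s' w) (Z s s' w) \<partial>(P s s')))"

end

theory Submission
  imports Defs
begin

text \<open>Shaping adds a discounted potential difference to each reward term. Under the
  expectation, the potentials of the random states cancel outcome by outcome:
  \<open>\<gamma> * \<Phi> (Y s s' w)\<close> from the second term against the third, and
  \<open>\<gamma> * \<gamma> * \<Phi> (Z s s' w)\<close> from the first against the third. What
  survives is the constant \<open>\<Phi> s - \<gamma> * \<Phi> s'\<close>, the negative of what
  shaping adds to the leading term \<open>R s a s'\<close>. As a constant has itself as expectation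
  under a probability measure, the two shifts cancel.\<close>

theorem proposition2:
  fixes \<S> :: "'s measure" and \<A> :: "'a measure"
    and R :: "('s, 'a) reward" and \<Phi> :: "'s \<Rightarrow> real" and \<gamma> :: real
    and D\<^sub>S :: "'s measure" and D\<^sub>A :: "'a measure" and T :: "'s \<times> 'a \<Rightarrow> 's measure"
    and P :: "'s \<Rightarrow> 's \<Rightarrow> 'w measure" and X :: "'s \<Rightarrow> 's \<Rightarrow> 'w \<Rightarrow> 'a"
    and Y Z :: "'s \<Rightarrow> 's \<Rightarrow> 'w \<Rightarrow> 's"
  assumes "0 \<le> \<gamma>" and "\<gamma> \<le> 1"
    and "D\<^sub>S \<in> space (prob_algebra \<S>)" and "D\<^sub>A \<in> space (prob_algebra \<A>)"
    and "T \<in> \<S> \<Otimes>\<^sub>M \<A> \<rightarrow>\<^sub>M prob_algebra \<S>"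
    and "next_state_variables \<S> \<A> D\<^sub>A T P X Y Z"
    and "(\<lambda>(s, a, s'). R s a s') \<in> borel_measurable (\<S> \<Otimes>\<^sub>M \<A> \<Otimes>\<^sub>M \<S>)"
    and "\<Phi> \<in> borel_measurable \<S>"
    and "\<And>s s'. s \<in> space \<S> \<Longrightarrow> s' \<in> space \<S> \<Longrightarrow>
           integrable (P s s') (\<lambda>w. R s' (X s s' w) (Z s s' w))"
    and "\<And>s s'. s \<in> space \<S> \<Longrightarrow> s' \<in> space \<S> \<Longrightarrow>
           integrable (P s s') (\<lambda>w. R s (X s s' w) (Y s s' w))"
    and "\<And>s s'. s \<in> space \<S> \<Longrightarrow> s' \<in> space \<S> \<Longrightarrow>
           integrable (P s s') (\<lambda>w. R (Y s s' w) (X s s' w) (Z s s' w))"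
    and "\<And>s s'. s \<in> space \<S> \<Longrightarrow> s' \<in> space \<S> \<Longrightarrow>
           integrable (P s s') (\<lambda>w. \<Phi> (Y s s' w))"
    and "\<And>s s'. s \<in> space \<S> \<Longrightarrow> s' \<in> space \<S> \<Longrightarrow>
           integrable (P s s') (\<lambda>w. \<Phi> (Z s s' w))"
  shows "\<forall>s\<in>space \<S>. \<forall>a\<in>space \<A>. \<forall>s'\<in>space \<S>.
           dynamics_aware \<gamma> P X Y Z (shaped \<gamma> R \<Phi>) s a s' = dynamics_aware \<gamma> P X Y Z R s a s'"
proof (intro ballI)
  fix s a s'
  assume s: "s \<in> space \<S>" and "a \<in> space \<A>" and s': "s' \<in> space \<S>"
  interpret prob_space "P s s'"
    using assms(6) s s' by (auto simp: next_state_variables_def)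
  let ?I = "\<lambda>R w. \<gamma> * R s' (X s s' w) (Z s s' w) - R s (X s s' w) (Y s s' w)
    - \<gamma> * R (Y s s' w) (X s s' w) (Z s s' w)"
  \<comment> \<open>Needed for additivity: a non-integrable function has integral 0 by convention,
    and the constant would then be lost.\<close>
  have "integrable (P s s') (?I R)"
    using assms(9-11)[OF s s'] by simp
  \<comment> \<open>The cancellation is an identity of functions of the outcome, before any
    integration.\<close>
  moreover have "?I (shaped \<gamma> R \<Phi>) = (\<lambda>w. ?I R w + (\<Phi> s - \<gamma> * \<Phi> s'))"
    by (simp add: shaped_def algebra_simps)
  ultimately have "(\<integral>w. ?I (shaped \<gamma> R \<Phi>) w \<partial>(P s s')) =
      (\<integral>w. ?I R w \<partial>(P s s')) + (\<Phi> s - \<gamma> * \<Phi> s')"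
    \<comment> \<open>Total mass 1 evaluates the constant's integral; without the difference rule,
      the integral of \<open>?I R\<close> stays in one piece.\<close>
    by (simp add: prob_space del: Bochner_Integration.integral_diff)
  then show "dynamics_aware \<gamma> P X Y Z (shaped \<gamma> R \<Phi>) s a s' = dynamics_aware \<gamma> P X Y Z R s a s'"
    by (simp add: dynamics_aware_def shaped_def)
qed

end
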